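(* Let $1\le r<n$ and suppose $X\in\mathbb S^n$ has eigenvalues satisfying $\lambda_r(X)-\lambda_{r+1}(X)=\delta>0$, and denote $\Lambda_{r,n}=\max\{|\lambda_{r+1}(X)|,|\lambda_n(X)|\}$. Then for any $Y\in\mathbb S^n$, the quantity $$f_X(Y):=\max\{\lambda_1(Y),0\}-\max_{W\in\mathcal C_r^+(X)}\langle W,Y\rangle$$ satisfies $$0\le f_X(Y)\le\frac{8\|Y-X\|_F^2\,\Lambda_{r,n}}{\delta^2}+\frac{(8\sqrt2+16)\|Y-X\|_F^2}{\delta}.$$
   Context: $\mathbb S^n$ is the space of real symmetric $n\times n$ matrices with the trace inner product $\langle\cdot,\cdot\rangle$ and Frobenius norm $\|\cdot\|_F$; eigenvalues are ordered $\lambda_1\ge\dots\ge\lambda_n$. For $X\in\mathbb S^n$ with $\lambda_r(X)-\lambda_{r+1}(X)>0$, the $r$-th spectral plus set is $\mathcal C_r^+(X)=\{VSV^\top: S\in\mathbb S^r,\ S\succeq0,\ \operatorname{tr}(S)\le1\}$, where $V\in\mathbb R^{n\times r}$ is the matrix whose columns are orthonormal eigenvectors of $X$ corresponding to its $r$ largest eigenvalues. *)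

theory Defs
  imports "HOL-Analysis.Analysis" "HOL-Computational_Algebra.Polynomial"
begin

text \<open>On \<^typ>\<open>real^'n^'n\<close> the library's inner product and norm are the trace inner product and
  the Frobenius norm.\<close>

lemma inner_matrix_eq_trace: "A \<bullet> B = trace (transpose A ** B)" for A B :: "real^'n^'m"
  unfolding inner_vec_def trace_def transpose_def matrix_matrix_mult_def
  by (simp, rule sum.swap)

lemma norm_matrix_eq_Frobenius: "norm A = sqrt (trace (transpose A ** A))" for A :: "real^'n^'m"
  by (simp add: norm_eq_sqrt_inner inner_matrix_eq_trace)

definition symmetric :: "real^'n^'n \<Rightarrow> bool" where
  "symmetric A \<longleftrightarrow> transpose A = A"

definition pos_semidef :: "real^'n^'n \<Rightarrow> bool" where
  "pos_semidef A \<longleftrightarrow> symmetric A \<and> (\<forall>v. 0 \<le> v \<bullet> (A *v v))"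

definition charpoly :: "real^'n^'n \<Rightarrow> real poly" where
  "charpoly A = det (mat [:0, 1:] - (\<chi> i j. [:A $ i $ j:]))"

text \<open>The eigenvalues with multiplicity in decreasing order, indexed from 1 as
  $\lambda_1 \ge \dots \ge \lambda_n$. This is meant for symmetric matrices, which have exactly
  \<^term>\<open>CARD('n)\<close> real eigenvalues, and for \<open>1 \<le> k \<le> CARD('n)\<close>.\<close>

definition eigval :: "real^'n^'n \<Rightarrow> nat \<Rightarrow> real" where
  "eigval A k = rev (sorted_list_of_multiset (proots (charpoly A))) ! (k - 1)"

text \<open>The columns of \<open>V\<close> are orthonormal eigenvectors for the \<open>r = CARD('r)\<close> largest eigenvalues.
  The index type \<open>'r\<close> carries no order, so a bijection \<open>p\<close> says which column belongs to which
  eigenvalue.\<close>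

definition top_eigenvectors :: "real^'n^'n \<Rightarrow> real^'r^'n \<Rightarrow> bool" where
  "top_eigenvectors X V \<longleftrightarrow>
     transpose V ** V = mat 1 \<and>
     (\<exists>p. bij_betw p (UNIV :: 'r set) {1..CARD('r)} \<and>
        (\<forall>j. X *v column j V = eigval X (p j) *\<^sub>R column j V))"

text \<open>The \<open>r\<close>-th spectral plus set of \<open>X\<close>, given by a matrix \<open>V\<close> with \<^prop>\<open>top_eigenvectors X V\<close>.
  Under the eigenvalue gap it does not depend on the choice of \<open>V\<close>.\<close>

definition spectral_plus_set :: "real^'r^'n \<Rightarrow> (real^'n^'n) set" where
  "spectral_plus_set V = {V ** S ** transpose V | S. pos_semidef S \<and> trace S \<le> 1}"

definition spectral_gap_fun :: "real^'r^'n \<Rightarrow> real^'n^'n \<Rightarrow> real" where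
  "spectral_gap_fun V Y = max (eigval Y 1) 0 - (SUP W\<in>spectral_plus_set V. W \<bullet> Y)"

lemma compact_spectral_plus_set: "compact (spectral_plus_set (V :: real^'r^'n))"
proof -
  let ?S = "{S :: real^'r^'r. pos_semidef S \<and> trace S \<le> 1}"
  have quad: "v \<bullet> (S *v v) = (\<Sum>i\<in>UNIV. \<Sum>j\<in>UNIV. v $ i * S $ i $ j * v $ j)"
    for v :: "real^'r" and S :: "real^'r^'r"
    by (simp add: inner_vec_def matrix_vector_mult_def sum_distrib_left mult.assoc)
  have S_eq: "?S = {S. \<forall>i j. S $ i $ j = S $ j $ i} \<inter>
      {S. \<forall>v. 0 \<le> (\<Sum>i\<in>UNIV. \<Sum>j\<in>UNIV. v $ i * S $ i $ j * v $ j)} \<inter>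
      {S. (\<Sum>i\<in>UNIV. S $ i $ i) \<le> 1}"
    by (auto simp: pos_semidef_def symmetric_def quad trace_def transpose_def vec_eq_iff)
  have "closed ?S"
    unfolding S_eq
    by (intro closed_Int closed_Collect_all closed_Collect_eq closed_Collect_le continuous_intros)
  moreover have "bounded ?S"
  proof (rule boundedI)
    fix S :: "real^'r^'r" assume "S \<in> ?S"
    then have psd: "\<And>v. 0 \<le> v \<bullet> (S *v v)" and sym: "\<And>i j. S $ i $ j = S $ j $ i"
      and tr: "trace S \<le> 1"
      by (auto simp: pos_semidef_def symmetric_def transpose_def vec_eq_iff)
    have ax: "axis i 1 \<bullet> (S *v axis j 1) = S $ i $ j" for i j :: 'r
      by (simp add: inner_axis' matrix_vector_mul_component inner_axis)
    have diag0: "0 \<le> S $ i $ i" for i using psd[of "axis i 1"] by (simp add: ax)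
    have diag1: "S $ i $ i \<le> 1" for i
    proof -
      have "S $ i $ i \<le> (\<Sum>i\<in>UNIV. S $ i $ i)" by (rule member_le_sum) (auto simp: diag0)
      then show ?thesis using tr by (simp add: trace_def)
    qed
    have ent: "\<bar>S $ i $ j\<bar> \<le> 1" for i j
    proof -
      have "0 \<le> S $ i $ i + 2 * S $ i $ j + S $ j $ j"
        using psd[of "axis i 1 + axis j 1"] sym[of i j]
        by (simp add: matrix_vector_mult_add_rdistrib matrix_vector_right_distrib
            inner_add_left inner_add_right ax)
      moreover have "0 \<le> S $ i $ i - 2 * S $ i $ j + S $ j $ j"
        using psd[of "axis i 1 - axis j 1"] sym[of i j]
        by (simp add: matrix_vector_mult_diff_distrib inner_diff_left inner_diff_right ax)
      ultimately show ?thesis using diag1[of i] diag1[of j] by linarith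
    qed
    have "norm S \<le> (\<Sum>i\<in>UNIV. norm (S $ i))"
      unfolding norm_vec_def[of S] by (rule L2_set_le_sum) simp
    also have "\<dots> \<le> (\<Sum>i\<in>(UNIV :: 'r set). \<Sum>j\<in>(UNIV :: 'r set). 1)"
    proof (rule sum_mono)
      fix i
      have "norm (S $ i) \<le> (\<Sum>j\<in>UNIV. \<bar>S $ i $ j\<bar>)" by (rule norm_le_l1_cart)
      also have "\<dots> \<le> (\<Sum>j\<in>(UNIV :: 'r set). 1)" by (rule sum_mono) (rule ent)
      finally show "norm (S $ i) \<le> (\<Sum>j\<in>(UNIV :: 'r set). 1)" .
    qed
    finally show "norm S \<le> (\<Sum>i\<in>(UNIV :: 'r set). \<Sum>j\<in>(UNIV :: 'r set). 1)" .
  qed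
  ultimately have "compact ?S" by (simp add: compact_eq_bounded_closed)
  moreover have "continuous_on ?S (\<lambda>S. V ** S ** transpose V)"
    unfolding matrix_matrix_mult_def transpose_def by (intro continuous_intros)
  ultimately have "compact ((\<lambda>S. V ** S ** transpose V) ` ?S)"
    by (rule compact_continuous_image[rotated])
  moreover have "(\<lambda>S. V ** S ** transpose V) ` ?S = spectral_plus_set V"
    by (auto simp: spectral_plus_set_def)
  ultimately show ?thesis by simp
qed

lemma spectral_plus_set_max_attained:
  fixes V :: "real^'r^'n"
  shows "\<exists>W\<in>spectral_plus_set V. W \<bullet> Y = (SUP W\<in>spectral_plus_set V. W \<bullet> Y) \<and>
     (\<forall>W'\<in>spectral_plus_set V. W' \<bullet> Y \<le> W \<bullet> Y)"
proof -
  have "pos_semidef (0 :: real^'r^'r)" and "trace (0 :: real^'r^'r) \<le> 1"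
    by (simp_all add: pos_semidef_def symmetric_def transpose_def trace_def vec_eq_iff)
  then have "spectral_plus_set V \<noteq> {}" unfolding spectral_plus_set_def by blast
  moreover have "continuous_on (spectral_plus_set V) (\<lambda>W. W \<bullet> Y)"
    by (intro continuous_intros)
  ultimately obtain W where W: "W \<in> spectral_plus_set V"
      "\<forall>W'\<in>spectral_plus_set V. W' \<bullet> Y \<le> W \<bullet> Y"
    using continuous_attains_sup[OF compact_spectral_plus_set] by blast
  then have "(SUP W\<in>spectral_plus_set V. W \<bullet> Y) = W \<bullet> Y"
    by (intro cSup_eq_maximum) auto
  with W show ?thesis by (intro bexI[of _ W]) auto
qed

end

theory Submission
  imports Defs
begin

text \<open>
  Write \<open>E = Y - X\<close>, \<open>\<epsilon> = \<parallel>E\<parallel>\<close>, and let \<open>g\<close> be the maximum of \<open>\<langle>W, Y\<rangle>\<close> over the spectral plus set.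

  Every \<open>W = V S V\<^sup>T\<close> in that set is positive semidefinite of trace at most 1. Evaluating the
  trace of \<open>W Y\<close> in an orthonormal eigenbasis of \<open>Y\<close> gives \<open>\<langle>W, Y\<rangle> \<le> \<lambda>\<^sub>1(Y) tr W\<close>
  (\<open>pos_semidef_inner_le\<close>), hence \<open>g \<le> max {\<lambda>\<^sub>1(Y), 0}\<close>. Conversely, the rank-one choices
  \<open>W = w w\<^sup>T\<close> show that \<open>g \<ge> w \<bullet> Y w\<close> for each \<open>w\<close> in the range of \<open>V\<close> with \<open>\<parallel>w\<parallel> \<le> 1\<close>
  (\<open>quad_form_le_SUP_spectral_plus_set\<close>).

  The upper bound is proved in the stronger form \<open>8 \<epsilon>\<^sup>2 / \<delta>\<close>
  (\<open>spectral_gap_fun_le_quadratic\<close>), which suffices as \<open>\<Lambda> \<ge> 0\<close>. As \<open>g \<ge> 0\<close>, only \<open>l - g\<close> with \<open>l = \<lambda>\<^sub>1(Y)\<close> has to be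
  estimated. If \<open>\<epsilon> \<ge> \<delta>/4\<close>, then testing with the leading eigenvector of \<open>X\<close> gives
  \<open>l - g \<le> 2 \<epsilon> \<le> 8 \<epsilon>\<^sup>2 / \<delta>\<close>. If \<open>\<epsilon> < \<delta>/4\<close>, take a unit vector \<open>u\<close> with \<open>Y u = l u\<close> and split
  \<open>u = a + b\<close> into its components along and orthogonal to the range of \<open>V\<close>. Both subspaces are
  invariant under \<open>X\<close>, so taking inner products of \<open>Y u = l u\<close> with \<open>b\<close> and with \<open>a\<close> gives
  \<open>l \<parallel>b\<parallel>\<^sup>2 = b \<bullet> X b + b \<bullet> E u\<close> and \<open>a \<bullet> Y a = l \<parallel>a\<parallel>\<^sup>2 - a \<bullet> E b\<close>.
  Since \<open>b \<bullet> X b \<le> \<lambda>\<^sub>r\<^sub>+\<^sub>1(X) \<parallel>b\<parallel>\<^sup>2\<close> and \<open>l \<ge> \<lambda>\<^sub>r(X) - \<epsilon>\<close>, the first identity says that \<open>\<parallel>b\<parallel>\<close> is of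
  order \<open>\<epsilon>/\<delta>\<close> (a Davis-Kahan estimate). Testing with \<open>a / \<parallel>a\<parallel>\<close>, the second one
  gives \<open>(l - g) \<parallel>a\<parallel> \<le> \<epsilon> \<parallel>b\<parallel>\<close>, which is of second order.

  The spectral theory behind this rests on \<open>extend_to_eigenbasis\<close>: every orthonormal family of
  eigenvectors of a symmetric matrix extends to an orthonormal eigenbasis. By \<open>proots_charpoly\<close>
  the roots of the characteristic polynomial are the eigenvalues of any such basis with
  multiplicity. Extending the columns of \<open>V\<close> and cancelling their eigenvalues from both sides
  leaves exactly \<open>\<lambda>\<^sub>r\<^sub>+\<^sub>1, \<dots>, \<lambda>\<^sub>n\<close> for the added basis vectors
  (\<open>leading_eigenvectors_tail_bound\<close>).
\<close>

section \<open>Orthonormal eigenbases of symmetric matrices\<close>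

definition quad_form :: "real^'n^'n \<Rightarrow> real^'n \<Rightarrow> real" where
  "quad_form A v = v \<bullet> (A *v v)"

text \<open>The eigenvalue of a unit eigenvector is the value of the quadratic form at it. With this
  encoding a set of vectors carries its own eigenvalues.\<close>

definition orthonormal_eigenvectors :: "real^'n^'n \<Rightarrow> (real^'n) set \<Rightarrow> bool" where
  "orthonormal_eigenvectors A B \<longleftrightarrow> pairwise orthogonal B \<and>
     (\<forall>b\<in>B. norm b = 1 \<and> A *v b = quad_form A b *\<^sub>R b)"

lemma symmetric_inner_swap:
  assumes "symmetric A"
  shows "x \<bullet> (A *v y) = y \<bullet> (A *v x)"
  by (metis assms symmetric_def dot_lmul_matrix transpose_matrix_vector inner_commute)

lemma norm_matrix_vector_mult_le: "norm (A *v x) \<le> norm A * norm x" for A :: "real^'n^'m"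
proof -
  have "norm (A *v x) = L2_set (\<lambda>i. norm (A $ i \<bullet> x)) UNIV"
    by (simp add: norm_vec_def matrix_vector_mul_component)
  also have "\<dots> \<le> L2_set (\<lambda>i. norm (A $ i) * norm x) UNIV"
    by (rule L2_set_mono) (auto simp: Cauchy_Schwarz_ineq2)
  also have "\<dots> = norm A * norm x"
    by (simp add: L2_set_left_distrib norm_vec_def[of A])
  finally show ?thesis .
qed

lemma abs_bilinear_form_le: "\<bar>x \<bullet> (A *v y)\<bar> \<le> norm x * norm A * norm y" for A :: "real^'n^'m"
proof -
  have "\<bar>x \<bullet> (A *v y)\<bar> \<le> norm x * norm (A *v y)" by (rule Cauchy_Schwarz_ineq2)
  also have "\<dots> \<le> norm x * (norm A * norm y)"
    by (intro mult_left_mono norm_matrix_vector_mult_le) auto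
  finally show ?thesis by (simp add: mult.assoc)
qed

lemma quad_form_scaleR: "quad_form A (c *\<^sub>R x) = c\<^sup>2 * quad_form A x"
  by (simp add: quad_form_def matrix_vector_mult_scaleR power2_eq_square)

lemma quad_form_add:
  assumes "symmetric A"
  shows "quad_form A (x + y) = quad_form A x + 2 * (x \<bullet> (A *v y)) + quad_form A y"
  using symmetric_inner_swap[OF assms, of y x]
  by (simp add: quad_form_def matrix_vector_right_distrib inner_add_left inner_add_right)

text \<open>A maximizer \<open>u\<close> of the quadratic form on the unit sphere of the subspace is an eigenvector:
  with \<open>m\<close> the maximum, the residual \<open>w = A u - m u\<close> lies in the subspace, and comparing the values
  at \<open>u + t w\<close> and \<open>u\<close> bounds the linear term \<open>2 t \<parallel>w\<parallel>\<^sup>2\<close> by a multiple of \<open>t\<^sup>2\<close>.\<close>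

lemma eigenvector_in_invariant_subspace:
  fixes A :: "real^'n^'n"
  assumes A: "symmetric A" and S: "subspace S" and inv: "\<And>x. x \<in> S \<Longrightarrow> A *v x \<in> S"
    and x0: "x0 \<in> S" "x0 \<noteq> 0"
  obtains u where "u \<in> S" "norm u = 1" "A *v u = quad_form A u *\<^sub>R u"
proof -
  have "compact (sphere 0 1 \<inter> S)" by (simp add: compact_Int_closed closed_subspace S)
  moreover have "(1 / norm x0) *\<^sub>R x0 \<in> sphere 0 1 \<inter> S"
    using x0 S by (simp add: subspace_scale)
  moreover have "continuous_on (sphere 0 1 \<inter> S) (quad_form A)"
    unfolding quad_form_def by (intro continuous_intros)
  ultimately obtain u where u: "u \<in> S" "norm u = 1"
    and max: "\<And>x. norm x = 1 \<Longrightarrow> x \<in> S \<Longrightarrow> quad_form A x \<le> quad_form A u"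
    using continuous_attains_sup[of "sphere 0 1 \<inter> S" "quad_form A"] by force
  define m where "m = quad_form A u"
  have le: "quad_form A x \<le> m * (norm x)\<^sup>2" if "x \<in> S" for x
  proof (cases "x = 0")
    case False
    have "quad_form A ((1 / norm x) *\<^sub>R x) \<le> m"
      unfolding m_def using False that S by (intro max) (auto simp: subspace_scale)
    then show ?thesis using False unfolding quad_form_scaleR by (simp add: field_simps)
  qed (simp add: quad_form_def)
  define w where "w = A *v u - m *\<^sub>R u"
  have wS: "w \<in> S" unfolding w_def using u S inv by (simp add: subspace_diff subspace_scale)
  define K where "K = m * (norm w)\<^sup>2 - quad_form A w"
  have quad: "2 * t * (w \<bullet> w) \<le> t\<^sup>2 * K" for t
  proof -
    have "quad_form A (t *\<^sub>R w + u) \<le> m * (norm (t *\<^sub>R w + u))\<^sup>2"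
      using wS u S by (intro le) (simp add: subspace_add subspace_scale)
    moreover have "(norm (t *\<^sub>R w + u))\<^sup>2 = t\<^sup>2 * (norm w)\<^sup>2 + 2 * t * (w \<bullet> u) + 1"
      using u unfolding power2_norm_eq_inner
      by (simp add: norm_eq_1 inner_add_left inner_add_right inner_commute[of u w]
          power2_eq_square algebra_simps)
    moreover have "w \<bullet> (A *v u) = w \<bullet> w + m * (w \<bullet> u)"
    proof -
      have "w \<bullet> w = w \<bullet> (A *v u - m *\<^sub>R u)" by (simp only: w_def[symmetric])
      then show ?thesis by (simp add: inner_diff_right)
    qed
    then have "quad_form A (t *\<^sub>R w + u) = t\<^sup>2 * quad_form A w + 2 * t * (w \<bullet> w + m * (w \<bullet> u)) + m"
      by (subst quad_form_add[OF A]) (simp add: quad_form_scaleR m_def)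
    ultimately show ?thesis by (simp only: K_def) (simp add: algebra_simps)
  qed
  have "w = 0"
  proof (rule ccontr)
    assume "w \<noteq> 0"
    define c where "c = w \<bullet> w"
    have c: "c > 0" using \<open>w \<noteq> 0\<close> by (simp add: c_def)
    \<comment> \<open>A positive \<open>t\<close> small enough for the linear term to dominate; the summand 1 covers \<open>K = 0\<close>.\<close>
    define t where "t = c / (\<bar>K\<bar> + 1)"
    have t: "t > 0" using c by (simp add: t_def add_nonneg_pos)
    have "t * (2 * c) \<le> t * (t * K)"
      using quad[of t] by (simp add: c_def power2_eq_square algebra_simps)
    then have "2 * c \<le> t * K" using t by simp
    also have "\<dots> \<le> t * (\<bar>K\<bar> + 1)" using t by (intro mult_left_mono) auto
    also have "\<dots> = c" by (simp add: t_def)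
    finally show False using c by simp
  qed
  then show ?thesis using that[of u] u by (simp add: w_def m_def)
qed

lemma orthonormal_eigenvectors_independent:
  assumes "orthonormal_eigenvectors A B"
  shows "independent B"
  using assms unfolding orthonormal_eigenvectors_def
  by (intro pairwise_orthogonal_independent) auto

text \<open>In an extension of maximal cardinality nothing is missing: otherwise the orthogonal
  complement would be a nonzero invariant subspace, and an eigenvector in it could be added.\<close>

lemma extend_to_eigenbasis:
  fixes A :: "real^'n^'n"
  assumes A: "symmetric A" and C: "orthonormal_eigenvectors A C"
  obtains B where "C \<subseteq> B" "orthonormal_eigenvectors A B" "span B = UNIV"
proof -
  let ?P = "\<lambda>B. C \<subseteq> B \<and> orthonormal_eigenvectors A B"
  have bound: "finite B \<and> card B \<le> DIM(real^'n)" if "?P B" for B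
    using that orthonormal_eigenvectors_independent independent_bound by blast
  obtain B where B: "?P B" and max: "\<And>B'. ?P B' \<Longrightarrow> card B' \<le> card B"
    using ex_has_greatest_nat[of ?P C card "Suc (DIM(real^'n))"] C bound
    by (metis le_imp_less_Suc subset_refl)
  have eig: "A *v b = quad_form A b *\<^sub>R b" "norm b = 1" if "b \<in> B" for b
    using B that by (auto simp: orthonormal_eigenvectors_def)
  have "span B = UNIV"
  proof (rule ccontr)
    assume "span B \<noteq> UNIV"
    then obtain x where x: "x \<noteq> 0" "\<And>y. y \<in> span B \<Longrightarrow> x \<bullet> y = 0"
      using span_not_UNIV_orthogonal[of B] by blast
    let ?S = "{x. \<forall>b\<in>B. x \<bullet> b = 0}"
    have "subspace ?S" by (auto simp: subspace_def inner_add_left)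
    moreover have "A *v y \<in> ?S" if "y \<in> ?S" for y
    proof -
      have "(A *v y) \<bullet> b = 0" if "b \<in> B" for b
        using symmetric_inner_swap[OF A, of b y] eig(1)[OF that] \<open>y \<in> ?S\<close> that
        by (simp add: inner_commute)
      then show ?thesis by simp
    qed
    moreover have "x \<in> ?S" using x by (simp add: span_base)
    ultimately obtain u where u: "u \<in> ?S" "norm u = 1" "A *v u = quad_form A u *\<^sub>R u"
      using eigenvector_in_invariant_subspace[OF A, of ?S x] x(1) by blast
    have "u \<notin> B" using u by (auto simp: norm_eq_1)
    moreover have "?P (insert u B)"
      using B u unfolding orthonormal_eigenvectors_def
      by (auto simp: pairwise_insert orthogonal_def inner_commute)
    ultimately show False using max[of "insert u B"] bound[OF B] by simp
  qed
  with B that show ?thesis by blast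
qed

lemma eigenbasis_finite_card:
  fixes A :: "real^'n^'n"
  assumes "orthonormal_eigenvectors A B" "span B = UNIV"
  shows "finite B" "card B = CARD('n)"
proof -
  have ind: "independent B" by (rule orthonormal_eigenvectors_independent[OF assms(1)])
  then show "finite B" by (rule independent_imp_finite)
  show "card B = CARD('n)"
    using ind assms(2) by (metis dim_UNIV dim_eq_card dim_span DIM_cart DIM_real mult.right_neutral)
qed

lemma eigenbasis_expand:
  fixes A :: "real^'n^'n"
  assumes "orthonormal_eigenvectors A B" "span B = UNIV"
  shows "(\<Sum>b\<in>B. (x \<bullet> b) *\<^sub>R b) = x"
  using assms eigenbasis_finite_card[OF assms]
  by (intro orthonormal_basis_expand) (auto simp: orthonormal_eigenvectors_def)

section \<open>Eigenvalues as roots of the characteristic polynomial\<close>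

text \<open>Over the polynomial ring, the matrix \<open>Q\<close> of basis vectors satisfies
  \<open>(x I - A) Q = Q D\<close> with \<open>D\<close> diagonal, and its determinant cancels because \<open>Q\<^sup>T Q = I\<close>.\<close>

lemma proots_charpoly:
  fixes A :: "real^'n^'n"
  assumes B: "orthonormal_eigenvectors A B" "span B = UNIV"
  shows "proots (charpoly A) = image_mset (quad_form A) (mset_set B)"
proof -
  obtain q where q: "bij_betw q (UNIV :: 'n set) B"
    using eigenbasis_finite_card[OF B] finite_same_card_bij[of "UNIV::'n set" B] by auto
  have qB: "q i \<in> B" for i using q by (auto simp: bij_betw_def)
  have ortho: "q i \<bullet> q j = (if i = j then 1 else 0)" for i j
  proof (cases "i = j")
    case False
    then have "q i \<noteq> q j" using q by (auto simp: bij_betw_def inj_on_def)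
    then show ?thesis using False B(1) qB
      by (auto simp: orthonormal_eigenvectors_def pairwise_def orthogonal_def)
  qed (use B(1) qB in \<open>auto simp: orthonormal_eigenvectors_def norm_eq_1\<close>)
  have eig: "(\<Sum>k\<in>UNIV. A $ i $ k * q j $ k) = quad_form A (q j) * q j $ i" for i j
  proof -
    have "(A *v q j) $ i = (quad_form A (q j) *\<^sub>R q j) $ i"
      using B(1) qB unfolding orthonormal_eigenvectors_def by metis
    then show ?thesis by (simp add: matrix_vector_mult_def)
  qed
  define Q :: "real poly^'n^'n" where "Q = (\<chi> i j. [:q j $ i:])"
  define D :: "real poly^'n^'n" where "D = (\<chi> i j. if i = j then [:- quad_form A (q j), 1:] else 0)"
  have const_sum: "(\<Sum>k\<in>S. [:f k:]) = [:\<Sum>k\<in>S. f k:]" for S :: "'n set" and f :: "'n \<Rightarrow> real"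
    by (induction S rule: infinite_finite_induct) auto
  have QQ: "transpose Q ** Q = mat 1"
  proof -
    have "(transpose Q ** Q) $ i $ j = [:q i \<bullet> q j:]" for i j
      by (simp add: matrix_matrix_mult_def transpose_def Q_def const_sum inner_vec_def mult.commute)
    then show ?thesis by (simp add: vec_eq_iff mat_def ortho one_pCons)
  qed
  have "(mat [:0, 1:] - (\<chi> i j. [:A $ i $ j:])) ** Q = Q ** D"
  proof -
    have "((mat [:0, 1:] - (\<chi> i j. [:A $ i $ j:])) ** Q) $ i $ j = (Q ** D) $ i $ j" for i j
    proof -
      have "((mat [:0, 1:] - (\<chi> i j. [:A $ i $ j:])) ** Q) $ i $ j
          = (\<Sum>k\<in>UNIV. (if i = k then [:0, 1:] * [:q j $ k:] else 0) - [:A $ i $ k * q j $ k:])"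
        by (auto simp: matrix_matrix_mult_def Q_def mat_def algebra_simps intro!: sum.cong)
      also have "\<dots> = [:0, 1:] * [:q j $ i:] - [:quad_form A (q j) * q j $ i:]"
        by (simp add: sum_subtractf const_sum eig)
      also have "\<dots> = Q $ i $ j * D $ j $ j" by (simp add: Q_def D_def)
      also have "\<dots> = (\<Sum>k\<in>UNIV. if k = j then Q $ i $ k * D $ k $ j else 0)" by simp
      also have "\<dots> = (\<Sum>k\<in>UNIV. Q $ i $ k * D $ k $ j)"
        by (rule sum.cong) (auto simp: D_def)
      also have "\<dots> = (Q ** D) $ i $ j" by (simp add: matrix_matrix_mult_def)
      finally show ?thesis .
    qed
    then show ?thesis by (simp add: vec_eq_iff)
  qed
  then have "charpoly A * det Q = det Q * det D"
    unfolding charpoly_def by (metis det_mul)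
  moreover have "det Q * det Q = 1"
    using QQ by (metis det_I det_mul det_transpose)
  ultimately have "charpoly A = det D"
    by (metis mult.commute mult_cancel_right mult_zero_left zero_neq_one)
  also have "\<dots> = (\<Prod>i\<in>UNIV. [:- quad_form A (q i), 1:])"
    by (subst det_diagonal) (auto simp: D_def)
  finally have "proots (charpoly A) = (\<Sum>i\<in>UNIV. {#quad_form A (q i)#})"
    by (simp add: proots_prod)
  also have "\<dots> = (\<Sum>b\<in>B. {#quad_form A b#})"
    by (rule sum.reindex_bij_betw[OF q])
  also have "\<dots> = image_mset (quad_form A) (mset_set B)"
    using eigenbasis_finite_card(1)[OF B] by (induction B rule: finite_induct) auto
  finally show ?thesis .
qed

text \<open>An eigenbasis guarantees \<open>n\<close> real roots, so the sorted root list has an entry for each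
  of the indices \<open>1, \<dots>, n\<close>.\<close>

lemma eigval_decreasing_enumeration:
  fixes A :: "real^'n^'n"
  assumes A: "symmetric A"
  shows "image_mset (eigval A) (mset_set {1..CARD('n)}) = proots (charpoly A)" (is ?multiset)
    and "\<And>i j. 1 \<le> i \<Longrightarrow> i \<le> j \<Longrightarrow> j \<le> CARD('n) \<Longrightarrow> eigval A j \<le> eigval A i"
proof -
  obtain B where B: "orthonormal_eigenvectors A B" "span B = UNIV"
    using extend_to_eigenbasis[OF A, of "{}"] by (auto simp: orthonormal_eigenvectors_def)
  define L where "L = rev (sorted_list_of_multiset (proots (charpoly A)))"
  have mset: "mset L = proots (charpoly A)" by (simp add: L_def)
  have len: "length L = CARD('n)"
    using mset eigenbasis_finite_card[OF B] unfolding proots_charpoly[OF B]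
    by (metis size_image_mset size_mset size_mset_set)
  have eig: "eigval A k = L ! (k - 1)" for k by (simp add: eigval_def L_def)
  have "map (eigval A) [1..<Suc CARD('n)] = L"
    by (rule nth_equalityI) (auto simp: len eig simp del: upt_Suc)
  moreover have "mset [1..<Suc CARD('n)] = mset_set {1..CARD('n)}"
    by (metis mset_upt atLeastLessThanSuc_atLeastAtMost)
  ultimately show ?multiset using mset by (metis mset_map)
  show "eigval A j \<le> eigval A i" if "1 \<le> i" "i \<le> j" "j \<le> CARD('n)" for i j
  proof -
    have "sorted (rev L)" by (simp add: L_def)
    then show ?thesis unfolding eig using that len by (intro sorted_rev_nth_mono) auto
  qed
qed

text \<open>In an eigenbasis extending \<open>C\<close>, the eigenvalues outside \<open>C\<close> form the multiset
  \<open>\<lambda>\<^sub>k\<^sub>+\<^sub>1, \<dots>, \<lambda>\<^sub>n\<close>, by cancelling those of \<open>C\<close>. A vector orthogonal to \<open>C\<close> is a combination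
  of these remaining eigenvectors, and one of them has eigenvalue \<open>\<lambda>\<^sub>k\<^sub>+\<^sub>1\<close>.\<close>

lemma leading_eigenvectors_tail_bound:
  fixes A :: "real^'n^'n"
  assumes A: "symmetric A" and C: "orthonormal_eigenvectors A C"
    and top: "image_mset (quad_form A) (mset_set C) = image_mset (eigval A) (mset_set {1..k})"
    and k: "k < CARD('n)"
  shows "\<And>x. (\<And>c. c \<in> C \<Longrightarrow> x \<bullet> c = 0) \<Longrightarrow> quad_form A x \<le> eigval A (k + 1) * (norm x)\<^sup>2"
    and "\<exists>u. norm u = 1 \<and> A *v u = eigval A (k + 1) *\<^sub>R u"
proof -
  obtain B where B: "C \<subseteq> B" "orthonormal_eigenvectors A B" "span B = UNIV"
    using extend_to_eigenbasis[OF A C] .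
  note fin = eigenbasis_finite_card[OF B(2,3)]
  have "image_mset (quad_form A) (mset_set C) + image_mset (quad_form A) (mset_set (B - C))
      = image_mset (quad_form A) (mset_set B)"
    using B(1) fin(1) finite_subset
    by (metis Diff_disjoint Diff_partition finite_Diff image_mset_union mset_set_Union)
  also have "\<dots> = image_mset (eigval A) (mset_set {1..CARD('n)})"
    using eigval_decreasing_enumeration(1)[OF A] proots_charpoly[OF B(2,3)] by simp
  also have "{1..CARD('n)} = {1..k} \<union> {k+1..CARD('n)}" using k by auto
  also have "image_mset (eigval A) (mset_set \<dots>)
      = image_mset (eigval A) (mset_set {1..k}) + image_mset (eigval A) (mset_set {k+1..CARD('n)})"
    by (subst mset_set_Union) auto
  finally have "image_mset (quad_form A) (mset_set (B - C))
      = image_mset (eigval A) (mset_set {k+1..CARD('n)})"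
    using top by simp
  from arg_cong[OF this, of set_mset]
  have tail: "quad_form A ` (B - C) = eigval A ` {k+1..CARD('n)}" using fin(1) by simp
  show "quad_form A x \<le> eigval A (k + 1) * (norm x)\<^sup>2" if x: "\<And>c. c \<in> C \<Longrightarrow> x \<bullet> c = 0" for x
  proof -
    have exp: "(\<Sum>b\<in>B. (x \<bullet> b) *\<^sub>R b) = x" by (rule eigenbasis_expand[OF B(2,3)])
    have eig: "A *v b = quad_form A b *\<^sub>R b" if "b \<in> B" for b
      using that B(2) by (simp add: orthonormal_eigenvectors_def)
    have "(A *v x) \<bullet> x = (A *v x) \<bullet> (\<Sum>b\<in>B. (x \<bullet> b) *\<^sub>R b)" by (simp only: exp)
    also have "\<dots> = (\<Sum>b\<in>B. (x \<bullet> b) * (x \<bullet> (A *v b)))"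
      using symmetric_inner_swap[OF A, of x]
      by (simp add: inner_sum_right inner_commute[of "A *v x"])
    also have "\<dots> = (\<Sum>b\<in>B. quad_form A b * (x \<bullet> b)\<^sup>2)"
      by (intro sum.cong) (auto simp: eig power2_eq_square)
    also have "\<dots> \<le> (\<Sum>b\<in>B. eigval A (k + 1) * (x \<bullet> b)\<^sup>2)"
    proof (rule sum_mono)
      fix b assume b: "b \<in> B"
      show "quad_form A b * (x \<bullet> b)\<^sup>2 \<le> eigval A (k + 1) * (x \<bullet> b)\<^sup>2"
      proof (cases "b \<in> C")
        case False
        with b tail obtain j where "k + 1 \<le> j" "j \<le> CARD('n)" "quad_form A b = eigval A j" by fastforce
        then show ?thesis
          using eigval_decreasing_enumeration(2)[OF A, of "k+1" j] by (intro mult_right_mono) auto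
      qed (simp add: x)
    qed
    also have "\<dots> = eigval A (k + 1) * (x \<bullet> (\<Sum>b\<in>B. (x \<bullet> b) *\<^sub>R b))"
      by (simp add: inner_sum_right sum_distrib_left power2_eq_square)
    finally show ?thesis
      unfolding exp by (simp add: power2_norm_eq_inner quad_form_def inner_commute)
  qed
  have "eigval A (k + 1) \<in> quad_form A ` (B - C)" unfolding tail using k by auto
  then show "\<exists>u. norm u = 1 \<and> A *v u = eigval A (k + 1) *\<^sub>R u"
    using B(2) by (auto simp: orthonormal_eigenvectors_def)
qed

lemma largest_eigenvalue:
  fixes A :: "real^'n^'n"
  assumes A: "symmetric A"
  shows "quad_form A x \<le> eigval A 1 * (norm x)\<^sup>2"
    and "\<exists>u. norm u = 1 \<and> A *v u = eigval A 1 *\<^sub>R u"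
  using leading_eigenvectors_tail_bound[OF A, of "{}" 0]
  by (simp_all add: orthonormal_eigenvectors_def)

section \<open>The linear functional on the spectral plus set\<close>

text \<open>The trace may be computed in any orthonormal basis, here in an eigenbasis of another matrix \<open>A\<close>:
  expand each standard basis vector in that eigenbasis and exchange the two sums.\<close>

lemma trace_eigenbasis:
  fixes A M :: "real^'n^'n"
  assumes B: "orthonormal_eigenvectors A B" "span B = UNIV"
  shows "trace M = (\<Sum>b\<in>B. quad_form M b)"
proof -
  have "trace M = (\<Sum>i\<in>UNIV. row i M \<bullet> (\<Sum>b\<in>B. (axis i 1 \<bullet> b) *\<^sub>R b))"
    by (simp add: eigenbasis_expand[OF B] trace_def inner_axis row_def)
  also have "\<dots> = (\<Sum>i\<in>UNIV. \<Sum>b\<in>B. b $ i * (M *v b) $ i)"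
    by (simp add: inner_sum_right inner_axis' matrix_vector_mul_component row_def)
  also have "\<dots> = (\<Sum>b\<in>B. quad_form M b)"
    by (subst sum.swap) (simp add: quad_form_def inner_vec_def)
  finally show ?thesis .
qed

text \<open>In an eigenbasis of \<open>Y\<close>, the trace of \<open>W Y\<close> is the sum of the eigenvalues of \<open>Y\<close> weighted by
  the nonnegative diagonal of \<open>W\<close>, whose total weight is the trace of \<open>W\<close>.\<close>

lemma pos_semidef_inner_le:
  fixes W Y :: "real^'n^'n"
  assumes W: "pos_semidef W" and Y: "symmetric Y"
  shows "W \<bullet> Y \<le> eigval Y 1 * trace W"
proof -
  obtain B where B: "orthonormal_eigenvectors Y B" "span B = UNIV"
    using extend_to_eigenbasis[OF Y, of "{}"] by (auto simp: orthonormal_eigenvectors_def)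
  have "W \<bullet> Y = trace (W ** Y)"
    using W by (simp add: inner_matrix_eq_trace pos_semidef_def symmetric_def)
  also have "\<dots> = (\<Sum>b\<in>B. quad_form (W ** Y) b)" by (rule trace_eigenbasis[OF B])
  also have "\<dots> = (\<Sum>b\<in>B. quad_form Y b * quad_form W b)"
  proof (rule sum.cong[OF refl])
    fix b assume "b \<in> B"
    then have "Y *v b = quad_form Y b *\<^sub>R b" using B(1) by (simp add: orthonormal_eigenvectors_def)
    then have "(W ** Y) *v b = quad_form Y b *\<^sub>R (W *v b)"
      by (metis matrix_vector_mul_assoc matrix_vector_mult_scaleR)
    then show "quad_form (W ** Y) b = quad_form Y b * quad_form W b"
      by (simp add: quad_form_def[of "W ** Y"] quad_form_def[of W])
  qed
  also have "\<dots> \<le> (\<Sum>b\<in>B. eigval Y 1 * quad_form W b)"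
  proof (intro sum_mono mult_right_mono)
    fix b assume "b \<in> B"
    then have "norm b = 1" using B(1) by (simp add: orthonormal_eigenvectors_def)
    then show "quad_form Y b \<le> eigval Y 1" using largest_eigenvalue(1)[OF Y, of b] by simp
    show "0 \<le> quad_form W b" using W by (simp add: pos_semidef_def quad_form_def)
  qed
  also have "\<dots> = eigval Y 1 * trace W" by (simp add: trace_eigenbasis[OF B] sum_distrib_left)
  finally show ?thesis .
qed

lemma spectral_plus_set_inner_le:
  fixes V :: "real^'r^'n" and Y :: "real^'n^'n"
  assumes V: "transpose V ** V = mat 1" and Y: "symmetric Y" and W: "W \<in> spectral_plus_set V"
  shows "W \<bullet> Y \<le> max (eigval Y 1) 0"
proof -
  obtain S where S: "W = V ** S ** transpose V" "pos_semidef S" "trace S \<le> 1"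
    using W by (auto simp: spectral_plus_set_def)
  have ray: "quad_form W v = quad_form S (transpose V *v v)" for v
  proof -
    have "W *v v = V *v (S *v (transpose V *v v))"
      by (simp only: S(1) matrix_vector_mul_assoc[symmetric])
    then show ?thesis
      by (simp add: quad_form_def dot_lmul_matrix)
  qed
  have "transpose W = W"
    using S(1,2) by (simp add: matrix_transpose_mul pos_semidef_def symmetric_def matrix_mul_assoc)
  then have psd: "pos_semidef W"
    using ray S(2) by (simp add: pos_semidef_def symmetric_def quad_form_def)
  have "trace W = trace (transpose V ** (V ** S))" unfolding S(1) by (rule trace_mul_sym)
  also have "\<dots> = trace S" by (simp add: matrix_mul_assoc V)
  finally have tr: "trace W \<le> 1" using S(3) by simp
  have "0 \<le> trace S"
  proof -
    have "0 \<le> S $ i $ i" for i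
    proof -
      have "0 \<le> axis i 1 \<bullet> (S *v axis i 1)" using S(2) by (simp add: pos_semidef_def)
      then show ?thesis by (simp add: inner_axis' matrix_vector_mul_component inner_axis)
    qed
    then show ?thesis by (simp add: trace_def sum_nonneg)
  qed
  then have tr0: "0 \<le> trace W" using \<open>trace (transpose V ** (V ** S)) = trace S\<close> S(1) trace_mul_sym by metis
  have "W \<bullet> Y \<le> eigval Y 1 * trace W" by (rule pos_semidef_inner_le[OF psd Y])
  also have "\<dots> \<le> max (eigval Y 1) 0 * trace W" using tr0 by (intro mult_right_mono) auto
  also have "\<dots> \<le> max (eigval Y 1) 0 * 1" using tr by (intro mult_left_mono) auto
  finally show ?thesis by simp
qed

text \<open>The witness is \<open>S = s s\<^sup>T\<close>, for which \<open>V S V\<^sup>T\<close> is the rank-one matrix of \<open>V s\<close>; its trace is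
  \<open>\<parallel>s\<parallel>\<^sup>2 = \<parallel>V s\<parallel>\<^sup>2\<close> because \<open>V\<close> is an isometry.\<close>

lemma quad_form_le_SUP_spectral_plus_set:
  fixes V :: "real^'r^'n" and Y :: "real^'n^'n"
  assumes V: "transpose V ** V = mat 1" and s: "norm (V *v s) \<le> 1"
  shows "quad_form Y (V *v s) \<le> (SUP W\<in>spectral_plus_set V. W \<bullet> Y)"
proof -
  define S :: "real^'r^'r" where "S = (\<chi> i j. s $ i * s $ j)"
  define w where "w = V *v s"
  have "w \<bullet> w = s \<bullet> s"
  proof -
    have "w \<bullet> w = s \<bullet> (transpose V *v (V *v s))"
      by (metis dot_lmul_matrix inner_commute transpose_matrix_vector w_def)
    then show ?thesis by (simp only: matrix_vector_mul_assoc V matrix_vector_mul_lid)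
  qed
  then have "s \<bullet> s \<le> 1" using s by (metis w_def norm_eq_sqrt_inner real_sqrt_le_1_iff)
  moreover have "trace S = s \<bullet> s" by (simp add: trace_def S_def inner_vec_def)
  moreover have "pos_semidef S"
  proof -
    have "S *v v = (s \<bullet> v) *\<^sub>R s" for v
      by (simp add: vec_eq_iff S_def matrix_vector_mult_def inner_vec_def sum_distrib_left mult_ac)
    then have "0 \<le> v \<bullet> (S *v v)" for v by (simp add: inner_commute[of v s])
    then show ?thesis
      by (simp add: pos_semidef_def symmetric_def transpose_def S_def vec_eq_iff mult.commute)
  qed
  ultimately have "V ** S ** transpose V \<in> spectral_plus_set V"
    unfolding spectral_plus_set_def by auto
  moreover have "(V ** S ** transpose V) \<bullet> Y = quad_form Y w"
  proof -
    have "(V ** S ** transpose V) $ i $ j = w $ i * w $ j" for i j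
      by (simp add: matrix_matrix_mult_def transpose_def S_def w_def matrix_vector_mult_def
          sum_distrib_left sum_distrib_right mult_ac)
    then show ?thesis
      by (simp add: inner_vec_def quad_form_def matrix_vector_mult_def sum_distrib_left mult_ac)
  qed
  ultimately show ?thesis
    using spectral_plus_set_max_attained[of V Y] by (metis w_def)
qed

section \<open>The second-order bound\<close>

text \<open>This removes the bijection between columns and eigenvalue indices, leaving the multiset form
  in which the tail bound applies.\<close>

lemma top_eigenvectors_leading:
  fixes X :: "real^'n^'n" and V :: "real^'r^'n"
  assumes "top_eigenvectors X V"
  defines "C \<equiv> range (\<lambda>j. column j V)"
  shows "orthonormal_eigenvectors X C"
    and "image_mset (quad_form X) (mset_set C) = image_mset (eigval X) (mset_set {1..CARD('r)})"
proof -
  obtain p where V: "transpose V ** V = mat 1"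
    and p: "bij_betw p (UNIV :: 'r set) {1..CARD('r)}"
    and eig: "\<And>j. X *v column j V = eigval X (p j) *\<^sub>R column j V"
    using assms(1) by (auto simp: top_eigenvectors_def)
  have inner: "column i V \<bullet> column j V = (if i = j then 1 else 0)" for i j
  proof -
    have "column i V \<bullet> column j V = (transpose V ** V) $ i $ j"
      by (simp add: inner_vec_def column_def matrix_matrix_mult_def transpose_def)
    then show ?thesis by (simp add: V mat_def)
  qed
  have ray: "quad_form X (column j V) = eigval X (p j)" for j
    by (simp add: quad_form_def eig inner)
  show "orthonormal_eigenvectors X C"
    using inner eig ray
    by (auto simp: orthonormal_eigenvectors_def C_def pairwise_def orthogonal_def norm_eq_1)
  have "inj (\<lambda>j. column j V)"
  proof (rule injI)
    fix i j assume "column i V = column j V"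
    then show "i = j" using inner[of i j] inner[of i i] by (auto split: if_splits)
  qed
  then have "image_mset (quad_form X) (mset_set C)
      = image_mset (\<lambda>j. eigval X (p j)) (mset_set UNIV)"
    by (simp add: C_def image_mset_mset_set[symmetric] multiset.map_comp comp_def ray)
  also have "\<dots> = image_mset (eigval X) (image_mset p (mset_set UNIV))"
    by (simp add: multiset.map_comp comp_def)
  also have "image_mset p (mset_set UNIV) = mset_set {1..CARD('r)}"
    using p by (simp add: bij_betw_def image_mset_mset_set)
  finally show "image_mset (quad_form X) (mset_set C)
      = image_mset (eigval X) (mset_set {1..CARD('r)})" .
qed

lemma spectral_gap_fun_nonneg:
  assumes "transpose V ** V = mat 1" and "symmetric Y"
  shows "0 \<le> spectral_gap_fun V Y"
  using spectral_plus_set_max_attained[of V Y] spectral_plus_set_inner_le[OF assms]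
  unfolding spectral_gap_fun_def by (metis diff_ge_0_iff_ge)

text \<open>The first-order effect of the perturbation cancels because the top eigenvector of \<open>Y\<close> is
  within \<open>O(\<epsilon>/\<delta>)\<close> of the range of \<open>V\<close>, and \<open>X\<close> does not couple that range to its orthogonal
  complement.\<close>

lemma spectral_gap_fun_le_quadratic:
  fixes X Y :: "real^'n^'n" and V :: "real^'r^'n"
  assumes r: "CARD('r) < CARD('n)" and X: "symmetric X" and Y: "symmetric Y"
    and gap: "eigval X CARD('r) - eigval X (CARD('r) + 1) = \<delta>" "\<delta> > 0"
    and top: "top_eigenvectors X V"
  shows "spectral_gap_fun V Y \<le> 8 * (norm (Y - X))\<^sup>2 / \<delta>"
proof -
  define E where "E = Y - X"
  define \<epsilon> where "\<epsilon> = norm E"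
  define g where "g = (SUP W\<in>spectral_plus_set V. W \<bullet> Y)"
  define l where "l = eigval Y 1"
  have \<epsilon>0: "\<epsilon> \<ge> 0" by (simp add: \<epsilon>_def)
  have Ymult: "Y *v x = X *v x + E *v x" for x
    by (simp add: E_def matrix_vector_mult_diff_rdistrib)
  obtain p where V: "transpose V ** V = mat 1"
    and p: "bij_betw p (UNIV :: 'r set) {1..CARD('r)}"
    and eig: "\<And>j. X *v column j V = eigval X (p j) *\<^sub>R column j V"
    using top by (auto simp: top_eigenvectors_def)
  have g_ge: "quad_form Y (V *v s) \<le> g" if "norm (V *v s) \<le> 1" for s
    unfolding g_def using that by (rule quad_form_le_SUP_spectral_plus_set[OF V])
  have g0: "0 \<le> g" using g_ge[of 0] by (simp add: quad_form_def)
  obtain u where u: "norm u = 1" "Y *v u = l *\<^sub>R u"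
    using largest_eigenvalue(2)[OF Y] by (auto simp: l_def)
  have uu: "u \<bullet> u = 1" using u(1) by (simp add: norm_eq_1)
  obtain j where j: "p j = 1"
    using p by (metis (no_types, lifting) One_nat_def Suc_leI atLeastAtMost_iff
        bij_betw_imp_surj_on imageE zero_less_card_finite order_refl)
  define v where "v = V *v axis j 1"
  have v_col: "v = column j V" by (simp add: v_def matrix_vector_mult_basis)
  have "column j V \<bullet> column j V = (transpose V ** V) $ j $ j"
    by (simp add: inner_vec_def column_def matrix_matrix_mult_def transpose_def)
  then have vv: "v \<bullet> v = 1" by (simp add: V mat_def v_col)
  then have v1: "norm v = 1" by (simp add: norm_eq_1)
  have ray_v: "eigval X 1 - \<epsilon> \<le> quad_form Y v"
  proof -
    have "quad_form Y v = eigval X 1 + v \<bullet> (E *v v)"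
      using eig[of j] by (simp add: quad_form_def Ymult inner_add_right v_col[symmetric] j vv)
    then show ?thesis using abs_bilinear_form_le[of v E v] v1 by (simp add: \<epsilon>_def)
  qed
  \<comment> \<open>The threshold is where the first-order bound \<open>2 \<epsilon>\<close> equals \<open>8 \<epsilon>\<^sup>2 / \<delta>\<close>.\<close>
  have "l - g \<le> 8 * \<epsilon>\<^sup>2 / \<delta>"
  proof (cases "\<epsilon> < \<delta> / 4")
    case False
    have "l = quad_form X u + u \<bullet> (E *v u)"
      using u(2) uu by (simp add: quad_form_def Ymult inner_add_right[symmetric])
    also have "\<dots> \<le> eigval X 1 + \<epsilon>"
      using largest_eigenvalue(1)[OF X, of u] abs_bilinear_form_le[of u E u] u(1) by (simp add: \<epsilon>_def)
    finally have "l - g \<le> 2 * \<epsilon>" using ray_v g_ge[of "axis j 1"] v1 by (simp add: v_def)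
    also have "2 * \<epsilon> * \<delta> \<le> 2 * \<epsilon> * (4 * \<epsilon>)" using False \<epsilon>0 by (intro mult_left_mono) auto
    then have "2 * \<epsilon> \<le> 8 * \<epsilon>\<^sup>2 / \<delta>" using gap(2) by (simp add: field_simps power2_eq_square)
    finally show ?thesis .
  next
    case True
    \<comment> \<open>\<open>V V\<^sup>T\<close> is the orthogonal projection onto the range of \<open>V\<close>.\<close>
    define s where "s = transpose V *v u"
    define a where "a = V *v s"
    define b where "b = u - a"
    have Vb: "transpose V *v b = 0"
    proof -
      have "transpose V *v a = s"
        unfolding a_def by (simp only: matrix_vector_mul_assoc V matrix_vector_mul_lid)
      then show ?thesis
        unfolding b_def by (simp only: matrix_vector_mult_diff_distrib s_def) simp
    qed
    have b_orth: "b \<bullet> (V *v t) = 0" for t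
      using Vb by (metis dot_lmul_matrix transpose_matrix_vector inner_zero_left)
    have b_col: "b \<bullet> column i V = 0" for i
      using b_orth[of "axis i 1"] by (simp add: matrix_vector_mult_basis)
    have ab: "b \<bullet> a = 0" by (simp add: a_def b_orth)
    have bXa: "b \<bullet> (X *v a) = 0"
    proof -
      have "a = (\<Sum>i\<in>UNIV. s $ i *\<^sub>R column i V)"
        by (simp add: a_def matrix_mult_sum scalar_mult_eq_scaleR)
      then have "X *v a = (\<Sum>i\<in>UNIV. s $ i *\<^sub>R (X *v column i V))"
        by (simp add: matrix_vector_mult_scaleR linear_sum[OF matrix_vector_mul_linear])
      then show ?thesis by (simp add: inner_sum_right eig b_col)
    qed
    have u_eq: "u = a + b" by (simp add: b_def)
    have pyth: "(norm a)\<^sup>2 + (norm b)\<^sup>2 = 1"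
      using uu ab by (simp add: u_eq power2_norm_eq_inner inner_add_left inner_add_right inner_commute)
    have tail: "quad_form X b \<le> eigval X (CARD('r) + 1) * (norm b)\<^sup>2"
      using leading_eigenvectors_tail_bound(1)[OF X top_eigenvectors_leading[OF top] r, of b] b_col
      by auto
    have "l \<ge> eigval X 1 - \<epsilon>"
      using ray_v largest_eigenvalue(1)[OF Y, of v] v1 by (simp add: l_def)
    moreover have "eigval X CARD('r) \<le> eigval X 1"
      using eigval_decreasing_enumeration(2)[OF X, of 1 "CARD('r)"] r by (simp add: Suc_leI)
    ultimately have l_ge: "l - eigval X (CARD('r) + 1) \<ge> \<delta> - \<epsilon>" using gap by linarith
    \<comment> \<open>The component of the eigenvalue equation along \<open>b\<close> shows that \<open>b\<close> is of size \<open>\<epsilon>/\<delta>\<close>.\<close>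
    have "l * (norm b)\<^sup>2 = b \<bullet> (Y *v u)"
      unfolding u(2) using ab by (simp add: u_eq inner_add_right power2_norm_eq_inner)
    also have "\<dots> = b \<bullet> (X *v (a + b)) + b \<bullet> (E *v u)"
      by (simp add: Ymult u_eq inner_add_right)
    also have "\<dots> = quad_form X b + b \<bullet> (E *v u)"
      using bXa by (simp add: matrix_vector_right_distrib inner_add_right quad_form_def)
    also have "b \<bullet> (E *v u) \<le> norm b * \<epsilon>"
      using abs_bilinear_form_le[of b E u] u(1) by (simp add: \<epsilon>_def)
    finally have "(l - eigval X (CARD('r) + 1)) * (norm b)\<^sup>2 \<le> norm b * \<epsilon>"
      using tail by (simp add: algebra_simps)
    moreover have "(3/4 * \<delta>) * (norm b)\<^sup>2 \<le> (l - eigval X (CARD('r) + 1)) * (norm b)\<^sup>2"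
      using l_ge True by (intro mult_right_mono) auto
    ultimately have "norm b * (3/4 * \<delta> * norm b) \<le> norm b * \<epsilon>"
      by (simp add: power2_eq_square algebra_simps)
    then have b_small: "3/4 * \<delta> * norm b \<le> \<epsilon>"
      using \<epsilon>0 by (cases "norm b = 0") auto
    then have "\<delta> * norm b \<le> \<delta> * (1/3)" using True by simp
    then have "norm b \<le> 1/3" using gap(2) by simp
    then have "(norm b)\<^sup>2 \<le> (1/3)\<^sup>2" by (intro power_mono) auto
    then have a2: "(norm a)\<^sup>2 \<ge> 8/9" using pyth by (simp add: power2_eq_square)
    have a_le1: "norm a \<le> 1"
    proof (rule power2_le_imp_le)
      show "(norm a)\<^sup>2 \<le> 1\<^sup>2"
        using pyth zero_le_power2[of "norm b"] unfolding one_power2 by linarith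
    qed simp
    have "(norm a)\<^sup>2 \<le> norm a * 1" unfolding power2_eq_square using a_le1 by (intro mult_left_mono) auto
    then have a_ge: "norm a \<ge> 8/9" using a2 by linarith
    then have a_pos: "norm a > 0" by linarith
    have "quad_form Y ((1 / norm a) *\<^sub>R a) \<le> g"
      using g_ge[of "(1 / norm a) *\<^sub>R s"] a_pos by (simp add: matrix_vector_mult_scaleR a_def)
    then have ga: "quad_form Y a \<le> g * (norm a)\<^sup>2"
      using a_pos unfolding quad_form_scaleR by (simp add: field_simps)
    \<comment> \<open>The component along \<open>a\<close> compares \<open>l\<close> with the value of \<open>Y\<close> at \<open>a\<close>, up to \<open>a \<bullet> E b\<close>.\<close>
    have "a \<bullet> (Y *v u) = l * (norm a)\<^sup>2"
      unfolding u(2) using ab by (simp add: u_eq inner_add_right power2_norm_eq_inner inner_commute)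
    then have "quad_form Y a + a \<bullet> (Y *v b) = l * (norm a)\<^sup>2"
      by (simp add: quad_form_def u_eq matrix_vector_right_distrib inner_add_right)
    moreover have "a \<bullet> (Y *v b) = a \<bullet> (E *v b)"
      using bXa symmetric_inner_swap[OF X, of a b] by (simp add: Ymult inner_add_right)
    moreover have "a \<bullet> (E *v b) \<le> norm a * (\<epsilon> * norm b)"
      using abs_bilinear_form_le[of a E b] by (simp add: \<epsilon>_def mult.assoc)
    ultimately have "norm a * ((l - g) * norm a) \<le> norm a * (\<epsilon> * norm b)"
      using ga by (simp add: power2_eq_square algebra_simps)
    then have lg: "(l - g) * norm a \<le> \<epsilon> * norm b" using a_pos by simp
    show ?thesis
    proof (cases "l \<le> g")
      case True
      moreover have "0 \<le> 8 * \<epsilon>\<^sup>2 / \<delta>" using gap(2) by simp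
      ultimately show ?thesis by linarith
    next
      case False
      then have "(l - g) * (8/9) \<le> (l - g) * norm a" using a_ge by (intro mult_left_mono) auto
      with lg have "(l - g) * (8/9) \<le> \<epsilon> * norm b" by linarith
      then have "\<delta> * ((l - g) * (8/9)) \<le> \<delta> * (\<epsilon> * norm b)" using gap(2) by (intro mult_left_mono) auto
      also have "\<dots> = \<epsilon> * (3/4 * \<delta> * norm b) * (4/3)" by simp
      also have "\<dots> \<le> \<epsilon> * \<epsilon> * (4/3)" using b_small \<epsilon>0 by (intro mult_right_mono mult_left_mono) auto
      finally have "\<delta> * (l - g) * (8/9) \<le> \<epsilon>\<^sup>2 * (4/3)"
        by (simp only: power2_eq_square mult.assoc)
      then have "\<delta> * (l - g) \<le> 8 * \<epsilon>\<^sup>2" using zero_le_power2[of \<epsilon>] by linarith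
      then show ?thesis using gap(2) by (simp add: field_simps)
    qed
  qed
  moreover have "0 - g \<le> 8 * \<epsilon>\<^sup>2 / \<delta>"
  proof -
    have "0 \<le> 8 * \<epsilon>\<^sup>2 / \<delta>" using gap(2) by simp
    then show ?thesis using g0 by linarith
  qed
  ultimately show ?thesis by (simp add: spectral_gap_fun_def g_def l_def \<epsilon>_def E_def max_def)
qed

theorem lemma3p9:
  fixes X Y :: "real^'n^'n" and V :: "real^'r^'n" and \<delta> \<Lambda> :: real
  assumes "CARD('r) < CARD('n)"
    and "symmetric X"
    and "eigval X CARD('r) - eigval X (CARD('r) + 1) = \<delta>"
    and "\<delta> > 0"
    and "\<Lambda> = max \<bar>eigval X (CARD('r) + 1)\<bar> \<bar>eigval X CARD('n)\<bar>"
    and "top_eigenvectors X V"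
    and "symmetric Y"
  shows "0 \<le> spectral_gap_fun V Y \<and>
    spectral_gap_fun V Y \<le>
      8 * (norm (Y - X))\<^sup>2 * \<Lambda> / \<delta>\<^sup>2 + (8 * sqrt 2 + 16) * (norm (Y - X))\<^sup>2 / \<delta>"
proof
  have "transpose V ** V = mat 1" using assms(6) by (simp add: top_eigenvectors_def)
  then show "0 \<le> spectral_gap_fun V Y" using assms(7) by (rule spectral_gap_fun_nonneg)
  have "spectral_gap_fun V Y \<le> 8 * (norm (Y - X))\<^sup>2 / \<delta>"
    using assms by (intro spectral_gap_fun_le_quadratic) auto
  also have "\<dots> \<le> (8 * sqrt 2 + 16) * (norm (Y - X))\<^sup>2 / \<delta>"
    using assms(4) by (intro divide_right_mono mult_right_mono) auto
  also have "\<dots> \<le> 8 * (norm (Y - X))\<^sup>2 * \<Lambda> / \<delta>\<^sup>2 + (8 * sqrt 2 + 16) * (norm (Y - X))\<^sup>2 / \<delta>"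
    using assms(5) by simp
  finally show "spectral_gap_fun V Y \<le>
      8 * (norm (Y - X))\<^sup>2 * \<Lambda> / \<delta>\<^sup>2 + (8 * sqrt 2 + 16) * (norm (Y - X))\<^sup>2 / \<delta>" .
qed

end
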